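(* Let $q\in\mathbb{N}$. Let $A(y)=\sum_{n=0}^{\infty}a_ny^n$ and $B(y)=\sum_{n=0}^{\infty}b_ny^n$ be formal power series in one variable over $\mathbb{C}$ and let $P(x)=\sum_{c\in C}P_cX^c$ be a formal power series in $q$ variables over $\mathbb{C}$. Suppose that the compositions $A\circ P$, $B\circ P$ and $(AB)\circ P$ all exist. Then $$(A\circ P)(B\circ P)=(AB)\circ P.$$
   Context: $\mathbb{N}$ is the set of positive integers, $\mathbb{N}_0=\mathbb{N}\cup\{0\}$, and $C:=\mathbb{N}_0^q$. A formal power series in $q$ variables $x=(x_1,\ldots,x_q)$ over $\mathbb{C}$ is a formal sum $f(x)=\sum_{c\in C}f_cX^c$ with $f_c\in\mathbb{C}$ and $X^c=x_1^{c_1}\cdots x_q^{c_q}$; it is identified with the map $c\mapsto f_c$. The product is the Cauchy product $(fg)_c=\sum_{a,b\in C,\ a+b=c}f_ag_b$ (for one variable, $(AB)_n=\sum_{j=0}^na_jb_{n-j}$). Powers: $f^0:=I$, where $I_{(0,\ldots,0)}=1$ and $I_c=0$ otherwise, and $f^n$ is the $n$-fold Cauchy product of $f$ with itself. Composition: for a one-variable series $A(y)=\sum_{n=0}^\infty a_ny^n$ and a $q$-variable series $P$, the composition $A\circ P$ is said to exist if for every $c\in C$ the series $\sum_{n=0}^{\infty}a_n(P^n)_c$ converges in $\mathbb{C}$ (in the ordinary sense of convergence of partial sums, not necessarily absolutely); in that case $A\circ P$ is the $q$-variable formal power series with coefficients $(A\circ P)_c:=\sum_{n=0}^{\infty}a_n(P^n)_c$.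 *)

theory Defs
  imports "HOL-Analysis.Analysis" "HOL-Computational_Algebra.Formal_Power_Series"
begin

text \<open>
  Multi-indices are vectors in \<^typ>\<open>nat ^ 'q\<close> (with \<open>q = CARD('q)\<close>), added componentwise.
  A formal power series in \<open>q\<close> variables is identified with its coefficient map; one-variable
  series are the library's \<^typ>\<open>complex fps\<close>, whose product is the Cauchy product.
\<close>

type_synonym 'q mseries = "nat ^ 'q \<Rightarrow> complex"

definition mseries_one :: "'q::finite mseries" where
  "mseries_one c = (if c = 0 then 1 else 0)"

definition mseries_mult :: "'q::finite mseries \<Rightarrow> 'q mseries \<Rightarrow> 'q mseries" where
  "mseries_mult f g c = (\<Sum>(a, b) \<in> {(a, b). a + b = c}. f a * g b)"

primrec mseries_power :: "'q::finite mseries \<Rightarrow> nat \<Rightarrow> 'q mseries" where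
  "mseries_power f 0 = mseries_one"
| "mseries_power f (Suc n) = mseries_mult f (mseries_power f n)"

text \<open>\<^const>\<open>summable\<close> and \<^const>\<open>suminf\<close> refer to convergence of the partial sums,
  so convergence may be conditional.\<close>

definition comp_exists :: "complex fps \<Rightarrow> 'q::finite mseries \<Rightarrow> bool" where
  "comp_exists A P \<longleftrightarrow> (\<forall>c. summable (\<lambda>n. fps_nth A n * mseries_power P n c))"

text \<open>Meaningful only when \<^const>\<open>comp_exists\<close> holds.\<close>

definition mseries_comp :: "complex fps \<Rightarrow> 'q::finite mseries \<Rightarrow> 'q mseries" where
  "mseries_comp A P c = (\<Sum>n. fps_nth A n * mseries_power P n c)"

text \<open>The index set of the Cauchy product is finite, so the sum in \<^const>\<open>mseries_mult\<close> is
  never the default value for infinite sets.\<close>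

lemma finite_mseries_mult_index: "finite {(a, b). a + b = (c :: nat ^ 'q::finite)}"
proof -
  have "finite {f :: 'q \<Rightarrow> nat. \<forall>i. f i \<in> {..vec_nth c i}}"
    using finite_PiE[of "UNIV :: 'q set" "\<lambda>i. {..vec_nth c i}"] by (simp add: PiE_def Pi_def)
  then have "finite (vec_lambda ` {f :: 'q \<Rightarrow> nat. \<forall>i. f i \<in> {..vec_nth c i}})"
    by (rule finite_imageI)
  moreover have "a \<in> vec_lambda ` {f :: 'q \<Rightarrow> nat. \<forall>i. f i \<in> {..vec_nth c i}}"
    if "\<forall>i. vec_nth a i \<le> vec_nth c i" for a :: "nat ^ 'q"
    using that by (intro image_eqI[of _ _ "vec_nth a"]) auto
  ultimately have fin: "finite {a :: nat ^ 'q. \<forall>i. vec_nth a i \<le> vec_nth c i}"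
    by (auto intro: finite_subset)
  have "{(a, b). a + b = c} \<subseteq>
      {a. \<forall>i. vec_nth a i \<le> vec_nth c i} \<times> {a. \<forall>i. vec_nth a i \<le> vec_nth c i}"
    by auto
  then show ?thesis
    using fin by (meson finite_SigmaI finite_subset)
qed

end

theory Submission imports Defs begin

text \<open>
  Write \<open>u\<^sub>a(n) = A\<^sub>n (P\<^sup>n)\<^sub>a\<close> and \<open>v\<^sub>b(n) = B\<^sub>n (P\<^sup>n)\<^sub>b\<close>. Since \<open>P\<^sup>i P\<^sup>j = P\<^sup>i\<^sup>+\<^sup>j\<close>, the terms of the
  series for \<open>((AB) \<circ> P)\<^sub>c\<close> are the finite sum, over \<open>a + b = c\<close>, of the Cauchy products of
  \<open>u\<^sub>a\<close> and \<open>v\<^sub>b\<close>. The individual Cauchy products need not converge, but each of them is Abel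
  summable to the product of the two sums. Hence the series for \<open>((AB) \<circ> P)\<^sub>c\<close>, which
  converges by assumption, is Abel summable to \<open>((A \<circ> P)(B \<circ> P))\<^sub>c\<close>, and by Abel's limit
  theorem this is also its ordinary sum.
\<close>

lemma summable_norm_powser_inside:
  fixes u :: "nat \<Rightarrow> complex"
  assumes "summable u" and "0 \<le> r" and "r < 1"
  shows "summable (\<lambda>n. norm (u n * of_real r ^ n))"
  using powser_insidea[of u 1 "of_real r"] assms by simp

text \<open>Multiplying by the geometric series \<open>1 / (1 - r)\<close> turns coefficients into
  their partial sums. For \<open>0 \<le> r < 1\<close> both factors converge absolutely, so this is
  a Cauchy product.\<close>

lemma suminf_partial_sums_powser:
  fixes u :: "nat \<Rightarrow> complex"
  assumes u: "summable u" and r: "0 \<le> r" "r < 1"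
  shows "(\<lambda>n. (\<Sum>k\<le>n. u k) * of_real r ^ n) sums ((\<Sum>n. u n * of_real r ^ n) / (1 - of_real r))"
proof -
  have g: "summable (\<lambda>n. norm (of_real r ^ n :: complex))"
    using r by (simp add: norm_power summable_geometric)
  have "(\<lambda>n. \<Sum>k\<le>n. (u k * of_real r ^ k) * of_real r ^ (n - k)) sums
      ((\<Sum>n. u n * of_real r ^ n) * (\<Sum>n. of_real r ^ n))"
    by (rule Cauchy_product_sums[OF summable_norm_powser_inside[OF u r] g])
  moreover have "(\<Sum>k\<le>n. (u k * of_real r ^ k) * of_real r ^ (n - k)) = (\<Sum>k\<le>n. u k) * of_real r ^ n" for n
    unfolding sum_distrib_right by (intro sum.cong) (auto simp: mult.assoc simp flip: power_add)
  ultimately show ?thesis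
    using r by (simp add: suminf_geometric)
qed

text \<open>With \<open>d n\<close> the error of the partial sum up to \<open>n\<close>, the
  difference of the power series at \<open>r\<close> and \<open>suminf u\<close> is
  \<open>(1 - r)\<close> times the sum of \<open>d n * r ^ n\<close>. As \<open>d\<close> tends to
  0, the tail contributes at most \<open>e / 2\<close> uniformly in \<open>r\<close>, and the head
  is killed by the factor \<open>1 - r\<close>.\<close>

theorem Abel_limit:
  fixes u :: "nat \<Rightarrow> complex"
  assumes u: "summable u"
  shows "((\<lambda>r. \<Sum>n. u n * of_real r ^ n) \<longlongrightarrow> suminf u) (at_left 1)"
proof (rule tendstoI)
  fix e :: real assume e: "e > 0"
  define d where "d n = (\<Sum>k\<le>n. u k) - suminf u" for n
  have "d \<longlonglongrightarrow> 0"
    using summable_LIMSEQ'[OF u] unfolding d_def by (simp add: LIM_zero_iff)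
  then obtain N where N: "\<And>n. n \<ge> N \<Longrightarrow> norm (d n) < e / 2"
    using LIMSEQ_D[of d 0 "e / 2"] e by auto
  \<comment> \<open>\<open>N\<close> and \<open>K\<close> are fixed before \<open>r\<close>, so
    \<open>(1 - r) * K\<close> tends to 0.\<close>
  define K where "K = (\<Sum>n<N. norm (d n))"
  have "((\<lambda>r. (1 - r) * K) \<longlongrightarrow> (1 - 1) * K) (at_left 1)"
    by (intro tendsto_intros)
  then have "\<forall>\<^sub>F r in at_left 1. (1 - r) * K < e / 2"
    using e by (intro order_tendstoD) auto
  moreover have "\<forall>\<^sub>F r in at_left 1. r \<in> {0<..<1::real}"
    by (rule eventually_at_left_real) simp
  ultimately show "\<forall>\<^sub>F r in at_left 1. dist (\<Sum>n. u n * of_real r ^ n) (suminf u) < e"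
  proof eventually_elim
    case (elim r)
    then have r: "0 \<le> r" "r < 1" by auto
    have geo: "(\<lambda>n. r ^ n) sums (1 / (1 - r))"
      using r geometric_sums[of r] by simp
    define F where "F = (\<Sum>n. u n * of_real r ^ n)"
    have "(\<lambda>n. (\<Sum>k\<le>n. u k) * of_real r ^ n - suminf u * of_real r ^ n) sums
        (F / (1 - of_real r) - suminf u * (1 / (1 - of_real r)))"
      unfolding F_def using r
      by (intro sums_diff suminf_partial_sums_powser[OF u] sums_mult geometric_sums) auto
    then have sd: "(\<lambda>n. d n * of_real r ^ n) sums ((F - suminf u) / (1 - of_real r))"
      by (simp add: d_def algebra_simps diff_divide_distrib)
    have hs: "(\<lambda>n. if n < N then norm (d n) else 0) sums K"
      unfolding K_def using sums_If_finite[of "\<lambda>n. n < N" "\<lambda>n. norm (d n)"]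
      by (simp add: lessThan_def)
    \<comment> \<open>A summable majorant of \<open>d n * r ^ n\<close>: below \<open>N\<close> use
      \<open>r ^ n \<le> 1\<close>, from \<open>N\<close> on use \<open>norm (d n) < e / 2\<close>.
      For simplicity the geometric term is kept for all \<open>n\<close>.\<close>
    have ss: "(\<lambda>n. (if n < N then norm (d n) else 0) + e / 2 * r ^ n) sums
        (K + e / 2 * (1 / (1 - r)))"
      by (intro sums_add hs sums_mult geo)
    have "norm (d n * of_real r ^ n) \<le> (if n < N then norm (d n) else 0) + e / 2 * r ^ n" for n
    proof (cases "n < N")
      case True
      then show ?thesis
        using r e by (simp add: norm_mult norm_power add_increasing2 mult_left_le power_le_one)
    next
      case False
      then show ?thesis
        using N[of n] r mult_right_mono[of "norm (d n)" "e / 2" "r ^ n"]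
        by (simp add: norm_mult norm_power)
    qed
    then have "norm (\<Sum>n. d n * of_real r ^ n) \<le> K + e / 2 * (1 / (1 - r))"
      using ss by (metis (no_types, lifting) norm_suminf_le sums_iff)
    then have "norm ((F - suminf u) / (1 - of_real r)) \<le> K + e / 2 * (1 / (1 - r))"
      using sd by (simp add: sums_iff)
    moreover have "norm (1 - of_real r :: complex) = 1 - r"
      using r by (metis abs_of_nonneg diff_ge_0_iff_ge less_imp_le norm_of_real of_real_1 of_real_diff)
    ultimately have "norm (F - suminf u) \<le> (K + e / 2 * (1 / (1 - r))) * (1 - r)"
      using r by (simp add: norm_divide pos_divide_le_eq)
    also have "\<dots> = (1 - r) * K + e / 2"
      using r by (simp add: field_simps)
    finally have "norm (F - suminf u) \<le> (1 - r) * K + e / 2" .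
    with elim show ?case
      unfolding F_def by (simp add: dist_norm)
  qed
qed

text \<open>For \<open>0 \<le> r < 1\<close> both power series converge absolutely, so their product
  is the series of the Cauchy product; then Abel's theorem applies to each factor. At
  \<open>r = 1\<close> the product series may diverge, hence the statement as a limit.\<close>

corollary Abel_limit_Cauchy_product:
  fixes u v :: "nat \<Rightarrow> complex"
  assumes "summable u" and "summable v"
  shows "((\<lambda>r. \<Sum>n. (\<Sum>k\<le>n. u k * v (n - k)) * of_real r ^ n) \<longlongrightarrow> suminf u * suminf v) (at_left 1)"
    (is "(?f \<longlongrightarrow> _) _")
    and "0 \<le> r \<Longrightarrow> r < 1 \<Longrightarrow> summable (\<lambda>n. (\<Sum>k\<le>n. u k * v (n - k)) * of_real r ^ n)"
proof -
  have prod: "(\<lambda>n. (\<Sum>k\<le>n. u k * v (n - k)) * of_real r ^ n) sums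
      ((\<Sum>n. u n * of_real r ^ n) * (\<Sum>n. v n * of_real r ^ n))" if r: "0 \<le> r" "r < 1" for r
  proof -
    have "(\<Sum>k\<le>n. (u k * of_real r ^ k) * (v (n - k) * of_real r ^ (n - k))) =
        (\<Sum>k\<le>n. u k * v (n - k)) * of_real r ^ n" for n
      unfolding sum_distrib_right
      by (intro sum.cong) (auto simp: mult_ac simp flip: power_add)
    then show ?thesis
      using Cauchy_product_sums[OF summable_norm_powser_inside[OF assms(1) r]
          summable_norm_powser_inside[OF assms(2) r]] by simp
  qed
  then show "0 \<le> r \<Longrightarrow> r < 1 \<Longrightarrow> summable (\<lambda>n. (\<Sum>k\<le>n. u k * v (n - k)) * of_real r ^ n)"
    by (meson sums_summable)
  have "\<forall>\<^sub>F r in at_left 1. r \<in> {0<..<1::real}"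
    by (rule eventually_at_left_real) simp
  then have "\<forall>\<^sub>F r in at_left 1. (\<Sum>n. u n * of_real r ^ n) * (\<Sum>n. v n * of_real r ^ n) = ?f r"
    by eventually_elim (use prod in \<open>auto simp: sums_iff\<close>)
  then show "(?f \<longlongrightarrow> suminf u * suminf v) (at_left 1)"
    by (rule Lim_transform_eventually[OF tendsto_mult[OF Abel_limit[OF assms(1)] Abel_limit[OF assms(2)]]])
qed

lemma mseries_mult_assoc: "mseries_mult (mseries_mult f g) h = mseries_mult f (mseries_mult g h)"
proof
  fix c
  have "mseries_mult (mseries_mult f g) h c =
      (\<Sum>(p, q)\<in>(SIGMA p:{(a, b). a + b = c}. {(a, b). a + b = fst p}). f (fst q) * g (snd q) * h (snd p))"
    unfolding mseries_mult_def by (subst sum.Sigma[symmetric])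
      (auto simp: finite_mseries_mult_index[unfolded case_prod_unfold] sum_distrib_right case_prod_unfold)
  \<comment> \<open>Both index sets encode triples \<open>x + y + z = c\<close>: the left one as
    \<open>((x + y, z), (x, y))\<close>, the right one as
    \<open>((x, y + z), (y, z))\<close>.\<close>
  also have "\<dots> = (\<Sum>(p, q)\<in>(SIGMA p:{(a, b). a + b = c}. {(a, b). a + b = snd p}).
      f (fst p) * (g (fst q) * h (snd q)))"
    by (rule sum.reindex_bij_witness[where
          i = "\<lambda>(p, q). ((fst p + fst q, snd q), (fst p, fst q))" and
          j = "\<lambda>(p, q). ((fst q, snd q + snd p), (snd q, snd p))"])
      (auto simp: add.assoc mult.assoc)
  also have "\<dots> = mseries_mult f (mseries_mult g h) c"
    unfolding mseries_mult_def by (subst sum.Sigma[symmetric])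
      (auto simp: finite_mseries_mult_index[unfolded case_prod_unfold] sum_distrib_left case_prod_unfold)
  finally show "mseries_mult (mseries_mult f g) h c = mseries_mult f (mseries_mult g h) c" .
qed

lemma mseries_mult_one_left:
  fixes f :: "'q::finite mseries"
  shows "mseries_mult mseries_one f = f"
proof
  fix c :: "nat ^ 'q"
  have "mseries_mult mseries_one f c = (\<Sum>(a, b)\<in>{(0 :: nat ^ 'q, c)}. mseries_one a * f b)"
    unfolding mseries_mult_def
    by (rule sum.mono_neutral_right) (auto simp: finite_mseries_mult_index mseries_one_def split: if_splits)
  then show "mseries_mult mseries_one f c = f c"
    by (simp add: mseries_one_def)
qed

lemma mseries_power_add:
  "mseries_power f (m + n) = mseries_mult (mseries_power f m) (mseries_power f n)"
  by (induction m) (simp_all add: mseries_mult_one_left mseries_mult_assoc)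

text \<open>In the \<open>k\<close>-th summand of the coefficient of \<open>A * B\<close>, the power
  \<open>P^n\<close> is split as \<open>P^k P^(n - k)\<close>, a different splitting for each
  \<open>k\<close>; then the two finite sums are swapped.\<close>

lemma mseries_power_fps_mult_nth:
  "fps_nth (A * B) n * mseries_power P n c =
    (\<Sum>(a, b)\<in>{(a, b). a + b = c}. \<Sum>k\<le>n.
      (fps_nth A k * mseries_power P k a) * (fps_nth B (n - k) * mseries_power P (n - k) b))"
proof -
  have "fps_nth (A * B) n * mseries_power P n c =
      (\<Sum>k\<le>n. fps_nth A k * fps_nth B (n - k) *
        mseries_mult (mseries_power P k) (mseries_power P (n - k)) c)"
    by (simp add: fps_mult_nth atLeast0AtMost sum_distrib_right flip: mseries_power_add)
  also have "\<dots> = (\<Sum>k\<le>n. \<Sum>(a, b)\<in>{(a, b). a + b = c}.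
      (fps_nth A k * mseries_power P k a) * (fps_nth B (n - k) * mseries_power P (n - k) b))"
    by (simp add: mseries_mult_def sum_distrib_left case_prod_unfold mult_ac)
  also have "\<dots> = (\<Sum>(a, b)\<in>{(a, b). a + b = c}. \<Sum>k\<le>n.
      (fps_nth A k * mseries_power P k a) * (fps_nth B (n - k) * mseries_power P (n - k) b))"
    unfolding case_prod_unfold by (rule sum.swap)
  finally show ?thesis .
qed

theorem theorem21:
  fixes A B :: "complex fps" and P :: "'q::finite mseries"
  assumes "comp_exists A P" and "comp_exists B P" and "comp_exists (A * B) P"
  shows "mseries_mult (mseries_comp A P) (mseries_comp B P) = mseries_comp (A * B) P"
proof
  fix c :: "nat ^ 'q"
  let ?I = "{(a, b). a + b = c}"
  define u where "u a n = fps_nth A n * mseries_power P n a" for a n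
  define v where "v b n = fps_nth B n * mseries_power P n b" for b n
  define w where "w n = fps_nth (A * B) n * mseries_power P n c" for n
  have u: "summable (u a)" and v: "summable (v a)" and w: "summable w" for a
    using assms unfolding comp_exists_def u_def v_def w_def by auto
  have w_eq: "w n = (\<Sum>p\<in>?I. \<Sum>k\<le>n. u (fst p) k * v (snd p) (n - k))" for n
    unfolding w_def u_def v_def mseries_power_fps_mult_nth by (simp add: case_prod_unfold)
  have "((\<lambda>r. \<Sum>p\<in>?I. \<Sum>n. (\<Sum>k\<le>n. u (fst p) k * v (snd p) (n - k)) * of_real r ^ n) \<longlongrightarrow>
      (\<Sum>p\<in>?I. suminf (u (fst p)) * suminf (v (snd p)))) (at_left 1)"
    by (intro tendsto_sum Abel_limit_Cauchy_product u v)
  moreover have "\<forall>\<^sub>F r in at_left 1. r \<in> {0<..<1::real}"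
    by (rule eventually_at_left_real) simp
  then have "\<forall>\<^sub>F r in at_left 1.
      (\<Sum>p\<in>?I. \<Sum>n. (\<Sum>k\<le>n. u (fst p) k * v (snd p) (n - k)) * of_real r ^ n) =
      (\<Sum>n. w n * of_real r ^ n)"
  proof eventually_elim
    case (elim r)
    \<comment> \<open>Exchanging the finite sum with the series needs each summand to converge,
      which is guaranteed for \<open>r < 1\<close> but not at \<open>r = 1\<close>.\<close>
    then show ?case
      unfolding w_eq sum_distrib_right[of _ ?I]
      by (intro suminf_sum[symmetric] Abel_limit_Cauchy_product u v) auto
  qed
  ultimately have "((\<lambda>r. \<Sum>n. w n * of_real r ^ n) \<longlongrightarrow>
      (\<Sum>p\<in>?I. suminf (u (fst p)) * suminf (v (snd p)))) (at_left 1)"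
    by (rule Lim_transform_eventually)
  \<comment> \<open>Here the convergence of \<open>w\<close> enters: its Abel limit is its ordinary
    sum, and limits along \<open>at_left 1\<close> are unique.\<close>
  then have "(\<Sum>p\<in>?I. suminf (u (fst p)) * suminf (v (snd p))) = suminf w"
    using Abel_limit[OF w] by (intro tendsto_unique[of "at_left (1::real)"]) auto
  then show "mseries_mult (mseries_comp A P) (mseries_comp B P) c = mseries_comp (A * B) P c"
    by (simp add: mseries_mult_def mseries_comp_def u_def[abs_def] v_def[abs_def] w_def[abs_def] case_prod_unfold)
qed

end
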